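(* There exists a function $(n,k,r)\mapsto d(n,k,r)\in\mathbb{N}$ (for integers $n,k\ge1$, $r\ge0$) such that for all $d\ge d(n,k,r)$ the map $$F\colon\mathscr{P}_d\times(\mathbb{R}^{nk}\setminus\Delta)\to{}_kJ^r(\mathbb{R}^n,\mathbb{R}),\qquad F(p,\overline{x})={}_kj^r(p)(\overline{x}),$$ is a submersion.
   Context: $\mathscr{P}_d$ is the space of real polynomials of degree at most $d$ on $\mathbb{R}^n$. $\mathbb{R}^{nk}\setminus\Delta$ is the set of $k$-tuples $\overline{x}=(x_1,\dots,x_k)$ of pairwise distinct points of $\mathbb{R}^n$. The space of jets of order $r$ is $J^r(\mathbb{R}^n,\mathbb{R})=\mathbb{R}^n\oplus\bigoplus_{\ell=0}^r\mathscr{P}_{\ell,n}$, where $\mathscr{P}_{\ell,n}$ is the space of homogeneous polynomials of degree $\ell$ in $n$ variables; the $r$-jet of a smooth $f\colon\mathbb{R}^n\to\mathbb{R}$ at $x$ is $j^r(f)(x)=\big(x,(\partial^{|\alpha|}f/\partial x^\alpha(x))_{|\alpha|\le r}\big)$, the partial derivative of index $\alpha$ being identified with the coefficient of the monomial $x^\alpha$. The multijet space is ${}_kJ^r(\mathbb{R}^n,\mathbb{R})=J^r(\mathbb{R}^n,\mathbb{R})^k$ and ${}_kj^r(f)(\overline{x})=(j^r(f)(x_1),\dots,j^r(f)(x_k))$. *)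

theory Defs
  imports "HOL-Analysis.Analysis" "HOL-Analysis.Finite_Function_Topology"
begin

text \<open>
  The dimension, the number of points, the jet order and the degree all vary inside the statement.
  All spaces are therefore realised as finite-dimensional subspaces of types of finitely supported
  functions, with the library's \<open>real_normed_vector\<close> structure on these types; on a
  finite-dimensional subspace its topology is the usual one. Coordinates are numbered from 0.
\<close>

type_synonym vec = "nat \<Rightarrow>\<^sub>0 real"
type_synonym multiindex = "nat \<Rightarrow>\<^sub>0 nat"
type_synonym poly_fn = "multiindex \<Rightarrow>\<^sub>0 real"  \<comment> \<open>coefficients of a polynomial\<close>
type_synonym jet = "vec \<times> poly_fn"

definition euclid :: "nat \<Rightarrow> vec set" where
  "euclid n = {x. Poly_Mapping.keys x \<subseteq> {..<n}}"

subsection \<open>Polynomials\<close>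

definition mdegree :: "multiindex \<Rightarrow> nat" where
  "mdegree \<alpha> = (\<Sum>i\<in>Poly_Mapping.keys \<alpha>. Poly_Mapping.lookup \<alpha> i)"

definition multiindices :: "nat \<Rightarrow> nat \<Rightarrow> multiindex set" where
  "multiindices n d = {\<alpha>. Poly_Mapping.keys \<alpha> \<subseteq> {..<n} \<and> mdegree \<alpha> \<le> d}"

lemma finite_multiindices: "finite (multiindices n d)"
proof -
  let ?S = "{f. \<forall>i. (i \<in> {..<n} \<longrightarrow> f i \<in> {..d}) \<and> (i \<notin> {..<n} \<longrightarrow> f i = (0::nat))}"
  have "Poly_Mapping.lookup \<alpha> i \<le> d" if "\<alpha> \<in> multiindices n d" for \<alpha> i
  proof (cases "i \<in> Poly_Mapping.keys \<alpha>")
    case True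
    then have "Poly_Mapping.lookup \<alpha> i \<le> mdegree \<alpha>"
      unfolding mdegree_def by (intro member_le_sum) auto
    with that show ?thesis by (simp add: multiindices_def)
  qed (simp add: in_keys_iff)
  then have "Poly_Mapping.lookup ` multiindices n d \<subseteq> ?S"
    by (auto simp: multiindices_def in_keys_iff subset_iff)
  moreover have "finite ?S"
    by (rule finite_set_of_finite_funs) auto
  ultimately have "finite (Poly_Mapping.lookup ` multiindices n d)"
    by (rule finite_subset)
  then show ?thesis
    by (rule finite_imageD) (simp add: inj_on_def)
qed

definition polys :: "nat \<Rightarrow> nat \<Rightarrow> poly_fn set" where
  "polys n d = {p. Poly_Mapping.keys p \<subseteq> multiindices n d}"

definition hom_polys :: "nat \<Rightarrow> nat \<Rightarrow> poly_fn set" where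
  "hom_polys n l = {p. \<forall>\<alpha>\<in>Poly_Mapping.keys p. Poly_Mapping.keys \<alpha> \<subseteq> {..<n} \<and> mdegree \<alpha> = l}"

lemma span_hom_polys: "span (\<Union>l\<le>r. hom_polys n l) = polys n r"
proof
  have look: "Poly_Mapping.lookup (c *\<^sub>R p) a = c * Poly_Mapping.lookup p a" for c p and a :: multiindex
  proof -
    have "finite {i. c *\<^sub>R Poly_Mapping.lookup p i \<noteq> 0}"
      by (rule finite_subset[OF _ finite_keys[of p]]) (auto simp: in_keys_iff)
    then show ?thesis
      by (simp add: scaleR_poly_mapping_def)
  qed
  have "subspace (polys n r)"
    unfolding subspace_def polys_def
    by (simp add: subset_iff in_keys_iff lookup_add look) (metis add_0)
  moreover have "(\<Union>l\<le>r. hom_polys n l) \<subseteq> polys n r"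
    by (auto simp: hom_polys_def polys_def multiindices_def)
  ultimately show "span (\<Union>l\<le>r. hom_polys n l) \<subseteq> polys n r"
    by (simp add: span_minimal)
  show "polys n r \<subseteq> span (\<Union>l\<le>r. hom_polys n l)"
  proof
    fix p assume p: "p \<in> polys n r"
    have "p = (\<Sum>a\<in>Poly_Mapping.keys p. Poly_Mapping.single a (Poly_Mapping.lookup p a))"
      by (rule poly_mapping_eqI) (auto simp: lookup_sum lookup_single when_def in_keys_iff)
    also have "\<dots> \<in> span (\<Union>l\<le>r. hom_polys n l)"
    proof (rule span_sum)
      fix a assume "a \<in> Poly_Mapping.keys p"
      with p have "a \<in> multiindices n r" by (auto simp: polys_def)
      then have "Poly_Mapping.single a (Poly_Mapping.lookup p a) \<in> (\<Union>l\<le>r. hom_polys n l)"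
        by (auto simp: hom_polys_def multiindices_def)
      then show "Poly_Mapping.single a (Poly_Mapping.lookup p a) \<in> span (\<Union>l\<le>r. hom_polys n l)"
        by (rule span_base)
    qed
    finally show "p \<in> span (\<Union>l\<le>r. hom_polys n l)" .
  qed
qed

definition monomial_eval :: "multiindex \<Rightarrow> vec \<Rightarrow> real" where
  "monomial_eval \<alpha> x = (\<Prod>i\<in>Poly_Mapping.keys \<alpha>. Poly_Mapping.lookup x i ^ Poly_Mapping.lookup \<alpha> i)"

definition poly_eval :: "poly_fn \<Rightarrow> vec \<Rightarrow> real" where
  "poly_eval p x = (\<Sum>\<alpha>\<in>Poly_Mapping.keys p. Poly_Mapping.lookup p \<alpha> * monomial_eval \<alpha> x)"

subsection \<open>Jets and multijets\<close>

definition partial_deriv :: "nat \<Rightarrow> (vec \<Rightarrow> real) \<Rightarrow> vec \<Rightarrow> real" where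
  "partial_deriv i f x = deriv (\<lambda>t. f (x + Poly_Mapping.single i t)) 0"

text \<open>
  The operators are composed as \<open>\<partial>\<^sub>0 ^ \<alpha>\<^sub>0 \<circ> \<partial>\<^sub>1 ^ \<alpha>\<^sub>1 \<circ> \<dots>\<close>; the order is
  immaterial for smooth functions.
\<close>

definition mpartial :: "multiindex \<Rightarrow> (vec \<Rightarrow> real) \<Rightarrow> vec \<Rightarrow> real" where
  "mpartial \<alpha> f = foldr (\<lambda>i g. (partial_deriv i ^^ Poly_Mapping.lookup \<alpha> i) g)
     (sorted_list_of_set (Poly_Mapping.keys \<alpha>)) f"

text \<open>
  The direct sum of the spaces of homogeneous polynomials of degrees \<open>0, \<dots>, r\<close>, as an internal
  direct sum in the space of polynomials: the summands involve disjoint sets of monomials.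
\<close>

definition jet_space :: "nat \<Rightarrow> nat \<Rightarrow> jet set" where
  "jet_space n r = euclid n \<times> span (\<Union>l\<le>r. hom_polys n l)"

definition jet :: "nat \<Rightarrow> nat \<Rightarrow> (vec \<Rightarrow> real) \<Rightarrow> vec \<Rightarrow> jet" where
  "jet n r f x = (x, \<Sum>\<alpha>\<in>multiindices n r. Poly_Mapping.single \<alpha> (mpartial \<alpha> f x))"

definition tuples :: "nat \<Rightarrow> 'a::zero set \<Rightarrow> (nat \<Rightarrow>\<^sub>0 'a) set" where
  "tuples k S = {u. Poly_Mapping.keys u \<subseteq> {..<k} \<and> (\<forall>j<k. Poly_Mapping.lookup u j \<in> S)}"

definition configs :: "nat \<Rightarrow> nat \<Rightarrow> (nat \<Rightarrow>\<^sub>0 vec) set" where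
  "configs n k = {u \<in> tuples k (euclid n). inj_on (Poly_Mapping.lookup u) {..<k}}"

definition multijet_space :: "nat \<Rightarrow> nat \<Rightarrow> nat \<Rightarrow> (nat \<Rightarrow>\<^sub>0 jet) set" where
  "multijet_space n k r = tuples k (jet_space n r)"

definition multijet :: "nat \<Rightarrow> nat \<Rightarrow> nat \<Rightarrow> (vec \<Rightarrow> real) \<Rightarrow> (nat \<Rightarrow>\<^sub>0 vec) \<Rightarrow> (nat \<Rightarrow>\<^sub>0 jet)" where
  "multijet n k r f u = (\<Sum>j<k. Poly_Mapping.single j (jet n r f (Poly_Mapping.lookup u j)))"

subsection \<open>Submersions between open subsets of finite-dimensional subspaces\<close>

text \<open>
  \<open>M\<close> is a relatively open subset of the finite-dimensional subspace \<open>V\<close>. Derivatives are taken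
  within \<open>M\<close>, so only their restrictions to \<open>V\<close> are meaningful (and unique). As \<open>V\<close> is
  finite-dimensional, a map is of class \<open>C\<^sup>m\<^sup>+\<^sup>1\<close> iff it is differentiable with all
  directional derivatives of class \<open>C\<^sup>m\<close>.
\<close>

primrec Ck_on :: "nat \<Rightarrow> 'a::real_normed_vector set \<Rightarrow> 'a set \<Rightarrow> ('a \<Rightarrow> 'b::real_normed_vector) \<Rightarrow> bool" where
  "Ck_on 0 V M f \<longleftrightarrow> continuous_on M f"
| "Ck_on (Suc m) V M f \<longleftrightarrow>
     (\<exists>f'. (\<forall>x\<in>M. (f has_derivative f' x) (at x within M)) \<and> (\<forall>v\<in>V. Ck_on m V M (\<lambda>x. f' x v)))"

definition smooth_map_on :: "'a::real_normed_vector set \<Rightarrow> 'a set \<Rightarrow> ('a \<Rightarrow> 'b::real_normed_vector) \<Rightarrow> bool" where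
  "smooth_map_on V M f \<longleftrightarrow> (\<forall>m. Ck_on m V M f)"

text \<open>The tangent spaces of \<open>M\<close> and \<open>W\<close> at every point are \<open>V\<close> and \<open>W\<close>.\<close>

definition submersion_on ::
  "'a::real_normed_vector set \<Rightarrow> 'a set \<Rightarrow> 'b::real_normed_vector set \<Rightarrow> ('a \<Rightarrow> 'b) \<Rightarrow> bool" where
  "submersion_on V M W f \<longleftrightarrow>
     subspace V \<and> openin (top_of_set V) M \<and> subspace W \<and> f ` M \<subseteq> W \<and>
     smooth_map_on V M f \<and>
     (\<forall>x\<in>M. \<exists>f'. (f has_derivative f') (at x within M) \<and> f' ` V = W)"

end

theory Submission
  imports Defs
begin

text \<open>
  \<open>F\<close> is linear in \<open>p\<close> and carries the base points \<open>x\<^sub>j\<close> along unchanged, so its differential is onto as soon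
  as the linear map \<open>p \<mapsto> (j\<^sup>r p (x\<^sub>j))\<^sub>j\<close> is onto for every fixed configuration, which is Hermite
  interpolation; degree \<open>(r + 1) k\<close> suffices. To interpolate at \<open>x\<^sub>j\<close>, multiply \<open>(x - x\<^sub>j)\<^sup>\<alpha>\<close> by a product \<open>P\<close> of
  powers of affine functions that vanishes to order \<open>r + 1\<close> at the other points but not at \<open>x\<^sub>j\<close>. Among the
  derivatives at \<open>x\<^sub>j\<close> of order at most \<open>|\<alpha>|\<close> only the one of index \<open>\<alpha>\<close> is nonzero, so descending
  induction on \<open>|\<alpha>|\<close> corrects the higher ones.
\<close>

section \<open>Finitely supported functions as a normed space\<close>

lemma lookup_scaleR [simp]:
  fixes p :: "'a \<Rightarrow>\<^sub>0 'b::real_vector"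
  shows "Poly_Mapping.lookup (c *\<^sub>R p) a = c *\<^sub>R Poly_Mapping.lookup p a"
proof -
  have "finite {i. c *\<^sub>R Poly_Mapping.lookup p i \<noteq> 0}"
    by (rule finite_subset[OF _ finite_keys[of p]]) (auto simp: in_keys_iff)
  then show ?thesis
    by (simp add: scaleR_poly_mapping_def)
qed

lemma scaleR_single: "c *\<^sub>R Poly_Mapping.single i x = Poly_Mapping.single i (c *\<^sub>R x)"
  by (rule poly_mapping_eqI) (simp add: lookup_single when_def)

lemma norm_poly_mapping_eq_sum:
  "norm x = (\<Sum>i\<in>Poly_Mapping.keys x. norm (Poly_Mapping.lookup x i))"
  by (simp add: norm_poly_mapping_def dist_poly_mapping_def)

lemma norm_lookup_le: "norm (Poly_Mapping.lookup x i) \<le> norm x"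
proof (cases "i \<in> Poly_Mapping.keys x")
  case True
  then show ?thesis
    unfolding norm_poly_mapping_eq_sum by (intro member_le_sum) auto
qed (simp add: in_keys_iff)

text \<open>The norm of a finitely supported function is its l1 norm, which dominates every single
  coordinate. Coordinates are thus linear polynomial functions on the ambient space, although that
  space is infinite-dimensional.\<close>

lemma bounded_linear_lookup:
  "bounded_linear (\<lambda>x::'a \<Rightarrow>\<^sub>0 'b::real_normed_vector. Poly_Mapping.lookup x i)"
  by (rule bounded_linear_intro[where K = 1]) (auto simp: lookup_add norm_lookup_le)

lemma bounded_linear_single:
  "bounded_linear (Poly_Mapping.single i :: 'b::real_normed_vector \<Rightarrow> 'a \<Rightarrow>\<^sub>0 'b)"
  by (rule bounded_linear_intro[where K = 1])
     (auto simp: single_add scaleR_single norm_poly_mapping_eq_sum)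

lemma sum_single_lookup:
  assumes "finite S" "Poly_Mapping.keys x \<subseteq> S"
  shows "(\<Sum>i\<in>S. Poly_Mapping.single i (Poly_Mapping.lookup x i)) = x"
  using assms
  by (intro poly_mapping_eqI) (auto simp: lookup_sum lookup_single when_def in_keys_iff)

lemma lookup_sum_single:
  assumes "finite S"
  shows "Poly_Mapping.lookup (\<Sum>i\<in>S. Poly_Mapping.single i (f i)) j = (if j \<in> S then f j else 0)"
  using assms by (simp add: lookup_sum lookup_single when_def)

section \<open>Iterated partial derivatives of polynomial functions\<close>

text \<open>Besides differentiability, the induction delivers that each directional derivative is
  again a polynomial function. This closure allows derivatives to be iterated.\<close>

lemma real_polynomial_function_has_derivative:
  assumes "real_polynomial_function f"
  shows "\<exists>f'. (\<forall>x. (f has_derivative f' x) (at x)) \<and> (\<forall>v. real_polynomial_function (\<lambda>x. f' x v))"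
  using assms
proof induction
  case (linear f)
  then show ?case
    by (intro exI[of _ "\<lambda>_. f"]) (auto intro: bounded_linear_imp_has_derivative)
next
  case (const c)
  then show ?case
    by (intro exI[of _ "\<lambda>_ _. 0"]) auto
next
  case (add f g)
  then obtain f' g' where
    "\<forall>x. (f has_derivative f' x) (at x)" "\<forall>v. real_polynomial_function (\<lambda>x. f' x v)"
    "\<forall>x. (g has_derivative g' x) (at x)" "\<forall>v. real_polynomial_function (\<lambda>x. g' x v)"
    by blast
  then show ?case
    by (intro exI[of _ "\<lambda>x v. f' x v + g' x v"]) (auto intro!: has_derivative_add)
next
  case (mult f g)
  then obtain f' g' where
    "\<forall>x. (f has_derivative f' x) (at x)" "\<forall>v. real_polynomial_function (\<lambda>x. f' x v)"
    "\<forall>x. (g has_derivative g' x) (at x)" "\<forall>v. real_polynomial_function (\<lambda>x. g' x v)"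
    by blast
  with mult.hyps show ?case
    by (intro exI[of _ "\<lambda>x v. f x * g' x v + f' x v * g x"])
       (auto intro!: has_derivative_mult real_polynomial_function.intros(3,4))
qed

lemma real_polynomial_function_bounded_linear_compose:
  assumes "real_polynomial_function g" "bounded_linear L"
  shows "real_polynomial_function (\<lambda>x. g (L x))"
  using real_polynomial_function_compose[OF polynomial_function_bounded_linear[OF assms(2)] assms(1)]
  by (simp add: o_def)

text \<open>Chain rule along the line \<open>t \<mapsto> x + single i t\<close>. It turns
  \<open>deriv\<close>, which is informative only where a derivative exists, into a value of the
  Frechet derivative, so that the sum and product rules become available.\<close>

lemma partial_deriv_eq:
  assumes "(f has_derivative f') (at x)"
  shows "partial_deriv i f x = f' (Poly_Mapping.single i 1)"
proof -
  interpret bounded_linear f' using assms by (rule has_derivative_bounded_linear)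
  have "((\<lambda>t. x + Poly_Mapping.single i t) has_derivative Poly_Mapping.single i) (at 0)"
    by (auto intro!: derivative_eq_intros bounded_linear_imp_has_derivative bounded_linear_single)
  moreover have "(f has_derivative f') (at (x + Poly_Mapping.single i 0))"
    using assms by simp
  ultimately have "((\<lambda>t. f (x + Poly_Mapping.single i t)) has_derivative
      (\<lambda>t. f' (Poly_Mapping.single i t))) (at 0)"
    by (rule has_derivative_compose)
  moreover have "(\<lambda>t. f' (Poly_Mapping.single i t)) = (*) (f' (Poly_Mapping.single i 1))"
  proof
    fix t
    show "f' (Poly_Mapping.single i t) = f' (Poly_Mapping.single i 1) * t"
      using scaleR[of t "Poly_Mapping.single i 1"] by (simp add: scaleR_single mult.commute)
  qed
  ultimately have "((\<lambda>t. f (x + Poly_Mapping.single i t)) has_field_derivative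
      f' (Poly_Mapping.single i 1)) (at 0)"
    unfolding has_field_derivative_def by (rule has_derivative_eq_rhs)
  then show ?thesis
    unfolding partial_deriv_def by (rule DERIV_imp_deriv)
qed

lemma real_polynomial_function_partial_deriv:
  assumes "real_polynomial_function f"
  shows "real_polynomial_function (partial_deriv i f)"
proof -
  obtain f' where f': "\<And>x. (f has_derivative f' x) (at x)" "\<And>v. real_polynomial_function (\<lambda>x. f' x v)"
    using real_polynomial_function_has_derivative[OF assms] by blast
  have "partial_deriv i f = (\<lambda>x. f' x (Poly_Mapping.single i 1))"
    by (rule ext) (rule partial_deriv_eq[OF f'(1)])
  with f'(2) show ?thesis by simp
qed

lemma real_polynomial_function_differentiable:
  assumes "real_polynomial_function f"
  obtains f' where "(f has_derivative f') (at x)"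
proof -
  obtain f' where "\<forall>x. (f has_derivative f' x) (at x)"
    using real_polynomial_function_has_derivative[OF assms] by blast
  then show thesis by (intro that) (rule spec)
qed

section \<open>Sum, product and translation rules for one partial derivative\<close>

lemma partial_deriv_add:
  assumes "real_polynomial_function f" "real_polynomial_function g"
  shows "partial_deriv i (\<lambda>x. f x + g x) = (\<lambda>x. partial_deriv i f x + partial_deriv i g x)"
proof
  fix x
  obtain f' where f': "(f has_derivative f') (at x)"
    using real_polynomial_function_differentiable[OF assms(1)] .
  obtain g' where g': "(g has_derivative g') (at x)"
    using real_polynomial_function_differentiable[OF assms(2)] .
  show "partial_deriv i (\<lambda>x. f x + g x) x = partial_deriv i f x + partial_deriv i g x"
    by (simp add: partial_deriv_eq[OF f'] partial_deriv_eq[OF g']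
        partial_deriv_eq[OF has_derivative_add[OF f' g']])
qed

lemma partial_deriv_mult:
  assumes "real_polynomial_function f" "real_polynomial_function g"
  shows "partial_deriv i (\<lambda>x. f x * g x) = (\<lambda>x. f x * partial_deriv i g x + partial_deriv i f x * g x)"
proof
  fix x
  obtain f' where f': "(f has_derivative f') (at x)"
    using real_polynomial_function_differentiable[OF assms(1)] .
  obtain g' where g': "(g has_derivative g') (at x)"
    using real_polynomial_function_differentiable[OF assms(2)] .
  show "partial_deriv i (\<lambda>x. f x * g x) x = f x * partial_deriv i g x + partial_deriv i f x * g x"
    by (simp add: partial_deriv_eq[OF f'] partial_deriv_eq[OF g']
        partial_deriv_eq[OF has_derivative_mult[OF f' g']])
qed

lemma partial_deriv_const: "partial_deriv i (\<lambda>x. c) = (\<lambda>x. 0)"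
  by (simp add: partial_deriv_def fun_eq_iff)

lemma partial_deriv_cmult:
  assumes "real_polynomial_function f"
  shows "partial_deriv i (\<lambda>x. c * f x) = (\<lambda>x. c * partial_deriv i f x)"
  using partial_deriv_mult[OF real_polynomial_function.intros(2) assms]
  by (simp add: partial_deriv_const)

lemma partial_deriv_shift: "partial_deriv i (\<lambda>x. f (x - a)) = (\<lambda>x. partial_deriv i f (x - a))"
  by (simp add: partial_deriv_def fun_eq_iff algebra_simps)

lemma partial_deriv_lookup:
  "partial_deriv i (\<lambda>x. Poly_Mapping.lookup x l) = (\<lambda>x. if i = l then 1 else 0)"
  by (rule ext)
     (simp add: partial_deriv_eq[OF bounded_linear_imp_has_derivative[OF bounded_linear_lookup]]
       lookup_single when_def)

text \<open>A flat list of directions, in any order and with repetitions, takes the place of a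
  multi-index, so that inductions can peel off one derivative at a time.\<close>

definition iter_deriv :: "nat list \<Rightarrow> (vec \<Rightarrow> real) \<Rightarrow> vec \<Rightarrow> real" where
  "iter_deriv L f = foldr partial_deriv L f"

lemma iter_deriv_Nil [simp]: "iter_deriv [] f = f"
  by (simp add: iter_deriv_def)

text \<open>The last entry is applied first, so peeling from the right changes the function being
  differentiated. Hence the reverse list inductions with that function generalised.\<close>

lemma iter_deriv_snoc: "iter_deriv (L @ [i]) f = iter_deriv L (partial_deriv i f)"
  by (simp add: iter_deriv_def)

lemma real_polynomial_function_iter_deriv:
  "real_polynomial_function f \<Longrightarrow> real_polynomial_function (iter_deriv L f)"
  by (induction L) (auto simp: iter_deriv_def intro: real_polynomial_function_partial_deriv)

lemma iter_deriv_add: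
  assumes "real_polynomial_function f" "real_polynomial_function g"
  shows "iter_deriv L (\<lambda>x. f x + g x) = (\<lambda>x. iter_deriv L f x + iter_deriv L g x)"
  using assms
  by (induction L arbitrary: f g rule: rev_induct)
     (auto simp: iter_deriv_snoc partial_deriv_add real_polynomial_function_partial_deriv)

lemma iter_deriv_cmult:
  assumes "real_polynomial_function f"
  shows "iter_deriv L (\<lambda>x. c * f x) = (\<lambda>x. c * iter_deriv L f x)"
  using assms
  by (induction L arbitrary: f rule: rev_induct)
     (auto simp: iter_deriv_snoc partial_deriv_cmult real_polynomial_function_partial_deriv)

lemma iter_deriv_zero: "iter_deriv L (\<lambda>x. 0) = (\<lambda>x. 0)"
  by (induction L rule: rev_induct) (auto simp: iter_deriv_snoc partial_deriv_const)

lemma iter_deriv_sum: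
  assumes "finite S" "\<And>s. s \<in> S \<Longrightarrow> real_polynomial_function (f s)"
  shows "iter_deriv L (\<lambda>x. \<Sum>s\<in>S. f s x) = (\<lambda>x. \<Sum>s\<in>S. iter_deriv L (f s) x)"
  using assms
proof (induction S)
  case empty
  then show ?case by (simp add: iter_deriv_zero)
next
  case (insert s S)
  have "iter_deriv L (\<lambda>x. \<Sum>s\<in>insert s S. f s x) = iter_deriv L (\<lambda>x. f s x + (\<Sum>s\<in>S. f s x))"
    using insert by simp
  also have "\<dots> = (\<lambda>x. iter_deriv L (f s) x + iter_deriv L (\<lambda>x. \<Sum>s\<in>S. f s x) x)"
    using insert by (intro iter_deriv_add) auto
  finally show ?case using insert by simp
qed

lemma iter_deriv_shift: "iter_deriv L (\<lambda>x. f (x - a)) = (\<lambda>x. iter_deriv L f (x - a))"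
  by (induction L arbitrary: f rule: rev_induct) (auto simp: iter_deriv_snoc partial_deriv_shift)

section \<open>Translation between multi-indices and lists of directions\<close>

definition deriv_list :: "multiindex \<Rightarrow> nat list" where
  "deriv_list \<alpha> =
     concat (map (\<lambda>i. replicate (Poly_Mapping.lookup \<alpha> i) i) (sorted_list_of_set (Poly_Mapping.keys \<alpha>)))"

lemma mpartial_eq_iter_deriv: "mpartial \<alpha> f = iter_deriv (deriv_list \<alpha>) f"
proof -
  have "foldr partial_deriv (replicate m i) g = (partial_deriv i ^^ m) g" for m i g
    by (induction m) auto
  then have "foldr partial_deriv (concat (map (\<lambda>i. replicate (h i) i) is)) f
      = foldr (\<lambda>i. partial_deriv i ^^ h i) is f" for h "is"
    by (induction "is") auto
  then show ?thesis
    by (simp add: mpartial_def iter_deriv_def deriv_list_def)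
qed

lemma length_deriv_list: "length (deriv_list \<alpha>) = mdegree \<alpha>"
proof -
  have "length (deriv_list \<alpha>) = sum_list (map (Poly_Mapping.lookup \<alpha>) (sorted_list_of_set (Poly_Mapping.keys \<alpha>)))"
    by (simp add: deriv_list_def length_concat comp_def)
  then show ?thesis
    by (simp add: mdegree_def sum_list_distinct_conv_sum_set)
qed

text \<open>Records how often each direction occurs and forgets the order of
  differentiation.\<close>

definition list_index :: "nat list \<Rightarrow> multiindex" where
  "list_index L = (\<Sum>i\<leftarrow>L. Poly_Mapping.single i 1)"

lemma list_index_deriv_list: "list_index (deriv_list \<alpha>) = \<alpha>"
proof -
  have *: "sum_list (replicate m (Poly_Mapping.single j (Suc 0))) = Poly_Mapping.single j m" for m j :: nat
    by (induction m) (auto simp flip: single_add)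
  have **: "(\<Sum>i\<leftarrow>concat (map f is). g i) = (\<Sum>j\<leftarrow>is. \<Sum>i\<leftarrow>f j. g i)"
    for f :: "nat \<Rightarrow> nat list" and g :: "nat \<Rightarrow> multiindex" and "is"
    by (induction "is") auto
  have "list_index (deriv_list \<alpha>) =
      (\<Sum>i\<leftarrow>sorted_list_of_set (Poly_Mapping.keys \<alpha>). Poly_Mapping.single i (Poly_Mapping.lookup \<alpha> i))"
    by (simp add: list_index_def deriv_list_def ** *)
  then show ?thesis
    by (simp add: sum_list_distinct_conv_sum_set sum_single_lookup)
qed

section \<open>Monomials\<close>

lemma mdegree_eq_sum:
  assumes "finite S" "Poly_Mapping.keys \<alpha> \<subseteq> S"
  shows "mdegree \<alpha> = (\<Sum>i\<in>S. Poly_Mapping.lookup \<alpha> i)"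
  unfolding mdegree_def using assms by (intro sum.mono_neutral_left) (auto simp: in_keys_iff)

lemma mdegree_zero [simp]: "mdegree 0 = 0"
  by (simp add: mdegree_def)

lemma mdegree_single [simp]: "mdegree (Poly_Mapping.single i m) = m"
  by (simp add: mdegree_def)

lemma keys_add_nat: "Poly_Mapping.keys (\<alpha> + \<beta>) = Poly_Mapping.keys \<alpha> \<union> Poly_Mapping.keys (\<beta>::multiindex)"
  by (auto simp: in_keys_iff lookup_add)

lemma mdegree_add: "mdegree (\<alpha> + \<beta>) = mdegree \<alpha> + mdegree \<beta>"
  by (simp add: mdegree_eq_sum[of "Poly_Mapping.keys \<alpha> \<union> Poly_Mapping.keys \<beta>"] keys_add_nat
      lookup_add sum.distrib)

lemma mdegree_list_index: "mdegree (list_index L) = length L"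
  by (induction L) (auto simp: list_index_def mdegree_add)

lemma monomial_eval_eq_prod:
  assumes "finite S" "Poly_Mapping.keys \<alpha> \<subseteq> S"
  shows "monomial_eval \<alpha> x = (\<Prod>i\<in>S. Poly_Mapping.lookup x i ^ Poly_Mapping.lookup \<alpha> i)"
  unfolding monomial_eval_def using assms by (intro prod.mono_neutral_left) (auto simp: in_keys_iff)

lemma monomial_eval_zero_index [simp]: "monomial_eval 0 x = 1"
  by (simp add: monomial_eval_def)

lemma monomial_eval_single: "monomial_eval (Poly_Mapping.single i m) x = Poly_Mapping.lookup x i ^ m"
  by (cases "m = 0") (auto simp: monomial_eval_def)

lemma monomial_eval_add: "monomial_eval (\<alpha> + \<beta>) x = monomial_eval \<alpha> x * monomial_eval \<beta> x"
  by (simp add: monomial_eval_eq_prod[of "Poly_Mapping.keys \<alpha> \<union> Poly_Mapping.keys \<beta>"] keys_add_nat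
      lookup_add power_add prod.distrib)

lemma monomial_eval_at_zero: "monomial_eval \<alpha> 0 = (if \<alpha> = 0 then 1 else 0)"
proof (cases "\<alpha> = 0")
  case False
  then obtain i where "i \<in> Poly_Mapping.keys \<alpha>" by (metis ex_in_conv keys_eq_empty)
  with False show ?thesis
    by (auto simp: monomial_eval_def in_keys_iff intro!: prod_zero)
qed simp

lemma real_polynomial_function_monomial_eval: "real_polynomial_function (monomial_eval \<alpha>)"
  unfolding monomial_eval_def[abs_def]
  by (intro real_polynomial_function_prod finite_keys
      real_polynomial_function_power[OF real_polynomial_function.intros(1)] bounded_linear_lookup)

lemma partial_deriv_power_lookup:
  "partial_deriv i (\<lambda>x. Poly_Mapping.lookup x i ^ m) = (\<lambda>x. real m * Poly_Mapping.lookup x i ^ (m - 1))"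
proof (induction m)
  case 0
  then show ?case by (simp add: partial_deriv_const)
next
  case (Suc m)
  have "real_polynomial_function (\<lambda>x::vec. Poly_Mapping.lookup x i)"
    by (intro real_polynomial_function.intros(1) bounded_linear_lookup)
  then have "partial_deriv i (\<lambda>x. Poly_Mapping.lookup x i * Poly_Mapping.lookup x i ^ m)
      = (\<lambda>x. Poly_Mapping.lookup x i * partial_deriv i (\<lambda>x. Poly_Mapping.lookup x i ^ m) x
          + partial_deriv i (\<lambda>x. Poly_Mapping.lookup x i) x * Poly_Mapping.lookup x i ^ m)"
    by (intro partial_deriv_mult) (auto intro: real_polynomial_function_power)
  then show ?case
    unfolding Suc partial_deriv_lookup by (cases m) (auto simp: algebra_simps)
qed

lemma partial_deriv_monomial_eval_other:
  assumes "Poly_Mapping.lookup \<gamma> i = 0"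
  shows "partial_deriv i (monomial_eval \<gamma>) = (\<lambda>x. 0)"
proof -
  have "monomial_eval \<gamma> (x + Poly_Mapping.single i t) = monomial_eval \<gamma> x" for x t
    unfolding monomial_eval_def using assms
    by (intro prod.cong) (auto simp: lookup_add lookup_single when_def in_keys_iff)
  then show ?thesis
    by (simp add: partial_deriv_def fun_eq_iff)
qed

text \<open>Split off the power of the \<open>i\<close>-th variable from a monomial free of it and
  apply the product rule. If the variable is absent, truncated subtraction returns \<alpha> itself,
  but the coefficient 0 keeps the formula correct.\<close>

lemma partial_deriv_monomial_eval:
  "partial_deriv i (monomial_eval \<alpha>) =
     (\<lambda>x. real (Poly_Mapping.lookup \<alpha> i) * monomial_eval (\<alpha> - Poly_Mapping.single i 1) x)"
proof -
  define m where "m = Poly_Mapping.lookup \<alpha> i"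
  define \<gamma> where "\<gamma> = \<alpha> - Poly_Mapping.single i m"
  have \<alpha>: "\<alpha> = Poly_Mapping.single i m + \<gamma>"
    by (rule poly_mapping_eqI) (auto simp: \<gamma>_def m_def lookup_add lookup_minus lookup_single when_def)
  have \<gamma>: "Poly_Mapping.lookup \<gamma> i = 0"
    by (simp add: \<gamma>_def m_def lookup_minus)
  have minus: "m \<noteq> 0 \<Longrightarrow> \<alpha> - Poly_Mapping.single i 1 = Poly_Mapping.single i (m - 1) + \<gamma>"
    by (rule poly_mapping_eqI) (auto simp: \<alpha> lookup_add lookup_minus lookup_single when_def)
  have "real_polynomial_function (\<lambda>x::vec. Poly_Mapping.lookup x i ^ m)"
    by (intro real_polynomial_function_power real_polynomial_function.intros(1) bounded_linear_lookup)
  from partial_deriv_mult[OF this real_polynomial_function_monomial_eval, of i \<gamma>]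
  have "partial_deriv i (monomial_eval \<alpha>) =
      (\<lambda>x. real m * Poly_Mapping.lookup x i ^ (m - 1) * monomial_eval \<gamma> x)"
    unfolding partial_deriv_monomial_eval_other[OF \<gamma>] partial_deriv_power_lookup
    by (simp add: \<alpha> monomial_eval_add[abs_def] monomial_eval_single)
  then show ?thesis
    by (cases "m = 0") (auto simp: minus monomial_eval_add monomial_eval_single mult.assoc
        simp flip: m_def simp del: One_nat_def)
qed

text \<open>Each derivative lowers one exponent and contributes a nonzero factor while that exponent
  is positive; only the constant monomial survives evaluation at 0. The list must therefore use up
  the exponents of \<alpha> exactly. Recording mere nonvanishing avoids factorials.\<close>

lemma iter_deriv_monomial_eval_at_zero:
  "iter_deriv L (monomial_eval \<alpha>) 0 \<noteq> 0 \<longleftrightarrow> list_index L = \<alpha>"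
proof (induction L arbitrary: \<alpha> rule: rev_induct)
  case Nil
  then show ?case by (auto simp: monomial_eval_at_zero list_index_def)
next
  case (snoc i L)
  have "iter_deriv (L @ [i]) (monomial_eval \<alpha>) 0 =
      real (Poly_Mapping.lookup \<alpha> i) * iter_deriv L (monomial_eval (\<alpha> - Poly_Mapping.single i 1)) 0"
    by (simp add: iter_deriv_snoc partial_deriv_monomial_eval iter_deriv_cmult
        real_polynomial_function_monomial_eval)
  moreover have "Poly_Mapping.lookup \<alpha> i \<noteq> 0 \<and> list_index L = \<alpha> - Poly_Mapping.single i 1 \<longleftrightarrow>
      list_index (L @ [i]) = \<alpha>"
  proof (cases "Poly_Mapping.lookup \<alpha> i = 0")
    case True
    \<comment> \<open>Both sides of the equivalence are false: the variable is absent from \<alpha>,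
      while the extended list differentiates in its direction at least once.\<close>
    have "Poly_Mapping.lookup (list_index (L @ [i])) i \<noteq> 0"
      by (simp add: list_index_def lookup_add)
    with True show ?thesis by auto
  next
    case False
    then have "\<alpha> = \<alpha> - Poly_Mapping.single i 1 + Poly_Mapping.single i 1"
      by (intro poly_mapping_eqI) (auto simp: lookup_add lookup_minus lookup_single when_def)
    with False show ?thesis
      by (auto simp: list_index_def)
  qed
  ultimately show ?case
    using snoc[of "\<alpha> - Poly_Mapping.single i 1"] by simp
qed

section \<open>Polynomial functions of bounded degree\<close>

text \<open>Degree bounds are attached to functions instead of coefficient families, so that
  products, powers and translates are formed pointwise.\<close>

definition poly_functions :: "nat \<Rightarrow> nat \<Rightarrow> (vec \<Rightarrow> real) set" where
  "poly_functions n d = poly_eval ` polys n d"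

lemma poly_eval_eq_sum:
  assumes "finite S" "Poly_Mapping.keys p \<subseteq> S"
  shows "poly_eval p = (\<lambda>x. \<Sum>\<alpha>\<in>S. Poly_Mapping.lookup p \<alpha> * monomial_eval \<alpha> x)"
  unfolding poly_eval_def using assms
  by (intro ext sum.mono_neutral_left) (auto simp: in_keys_iff)

lemma poly_eval_polys:
  assumes "p \<in> polys n d"
  shows "poly_eval p = (\<lambda>x. \<Sum>\<alpha>\<in>multiindices n d. Poly_Mapping.lookup p \<alpha> * monomial_eval \<alpha> x)"
  using assms by (intro poly_eval_eq_sum finite_multiindices) (simp add: polys_def)

text \<open>Arbitrary coefficients over one fixed index set replace the support of a polynomial,
  which may shrink under cancellation.\<close>

lemma poly_functions_iff:
  "f \<in> poly_functions n d \<longleftrightarrow> (\<exists>c. f = (\<lambda>x. \<Sum>\<alpha>\<in>multiindices n d. c \<alpha> * monomial_eval \<alpha> x))"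
proof
  assume "f \<in> poly_functions n d"
  then show "\<exists>c. f = (\<lambda>x. \<Sum>\<alpha>\<in>multiindices n d. c \<alpha> * monomial_eval \<alpha> x)"
    unfolding poly_functions_def using poly_eval_polys by blast
next
  assume "\<exists>c. f = (\<lambda>x. \<Sum>\<alpha>\<in>multiindices n d. c \<alpha> * monomial_eval \<alpha> x)"
  then obtain c where f: "f = (\<lambda>x. \<Sum>\<alpha>\<in>multiindices n d. c \<alpha> * monomial_eval \<alpha> x)" ..
  define p where "p = (\<Sum>\<alpha>\<in>multiindices n d. Poly_Mapping.single \<alpha> (c \<alpha>))"
  have lookup_p: "Poly_Mapping.lookup p \<alpha> = (if \<alpha> \<in> multiindices n d then c \<alpha> else 0)" for \<alpha>
    unfolding p_def by (rule lookup_sum_single[OF finite_multiindices])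
  then have "p \<in> polys n d"
    by (auto simp: polys_def in_keys_iff split: if_splits)
  moreover from this have "f = poly_eval p"
    by (simp add: poly_eval_polys f lookup_p)
  ultimately show "f \<in> poly_functions n d"
    by (auto simp: poly_functions_def)
qed

lemma real_polynomial_function_poly_functions:
  "f \<in> poly_functions n d \<Longrightarrow> real_polynomial_function f"
  by (auto simp: poly_functions_iff intro!: real_polynomial_function_sum finite_multiindices
      real_polynomial_function.intros(2,4) real_polynomial_function_monomial_eval)

lemma poly_functions_add:
  assumes "f \<in> poly_functions n d" "g \<in> poly_functions n d"
  shows "(\<lambda>x. f x + g x) \<in> poly_functions n d"
proof -
  obtain a b where "f = (\<lambda>x. \<Sum>\<alpha>\<in>multiindices n d. a \<alpha> * monomial_eval \<alpha> x)"
    "g = (\<lambda>x. \<Sum>\<alpha>\<in>multiindices n d. b \<alpha> * monomial_eval \<alpha> x)"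
    using assms by (auto simp: poly_functions_iff)
  then show ?thesis
    by (auto simp: poly_functions_iff sum.distrib distrib_right intro!: exI[of _ "\<lambda>\<alpha>. a \<alpha> + b \<alpha>"])
qed

lemma poly_functions_cmult:
  assumes "f \<in> poly_functions n d"
  shows "(\<lambda>x. c * f x) \<in> poly_functions n d"
proof -
  obtain a where "f = (\<lambda>x. \<Sum>\<alpha>\<in>multiindices n d. a \<alpha> * monomial_eval \<alpha> x)"
    using assms by (auto simp: poly_functions_iff)
  then show ?thesis
    by (auto simp: poly_functions_iff sum_distrib_left mult.assoc intro!: exI[of _ "\<lambda>\<alpha>. c * a \<alpha>"])
qed

lemma poly_functions_monomial_eval:
  assumes "\<alpha> \<in> multiindices n d"
  shows "monomial_eval \<alpha> \<in> poly_functions n d"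
  unfolding poly_functions_iff using assms
  by (intro exI[of _ "\<lambda>\<beta>. if \<beta> = \<alpha> then 1 else 0"])
     (simp add: finite_multiindices if_distrib[of "\<lambda>y. y * _"] cong: if_cong)

lemma poly_functions_const: "(\<lambda>x. c) \<in> poly_functions n d"
  using poly_functions_cmult[OF poly_functions_monomial_eval[of 0 n d], of c]
  by (simp add: multiindices_def)

lemma poly_functions_sum:
  assumes "\<And>s. s \<in> S \<Longrightarrow> f s \<in> poly_functions n d"
  shows "(\<lambda>x. \<Sum>s\<in>S. f s x) \<in> poly_functions n d"
proof (cases "finite S")
  case True
  then show ?thesis
    using assms by (induction S) (auto intro: poly_functions_add poly_functions_const)
qed (simp add: poly_functions_const)

lemma poly_functions_mult:
  assumes "f \<in> poly_functions n d" "g \<in> poly_functions n e"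
  shows "(\<lambda>x. f x * g x) \<in> poly_functions n (d + e)"
proof -
  obtain a b where fg: "f = (\<lambda>x. \<Sum>\<alpha>\<in>multiindices n d. a \<alpha> * monomial_eval \<alpha> x)"
    "g = (\<lambda>x. \<Sum>\<beta>\<in>multiindices n e. b \<beta> * monomial_eval \<beta> x)"
    using assms by (auto simp: poly_functions_iff)
  have "(\<lambda>x. f x * g x) =
      (\<lambda>x. \<Sum>\<alpha>\<in>multiindices n d. \<Sum>\<beta>\<in>multiindices n e. (a \<alpha> * b \<beta>) * monomial_eval (\<alpha> + \<beta>) x)"
    by (simp add: fg sum_product monomial_eval_add mult_ac)
  also have "\<dots> \<in> poly_functions n (d + e)"
    by (intro poly_functions_sum poly_functions_cmult poly_functions_monomial_eval)
       (auto simp: multiindices_def keys_add_nat mdegree_add)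
  finally show ?thesis .
qed

lemma poly_functions_prod:
  assumes "\<And>s. s \<in> S \<Longrightarrow> f s \<in> poly_functions n (d s)"
  shows "(\<lambda>x. \<Prod>s\<in>S. f s x) \<in> poly_functions n (\<Sum>s\<in>S. d s)"
proof (cases "finite S")
  case True
  then show ?thesis
    using assms by (induction S) (auto intro: poly_functions_mult poly_functions_const)
qed (simp add: poly_functions_const)

lemma poly_functions_power:
  assumes "f \<in> poly_functions n d"
  shows "(\<lambda>x. f x ^ m) \<in> poly_functions n (m * d)"
  using poly_functions_prod[of "{..<m}" "\<lambda>_. f" n "\<lambda>_. d"] assms by simp

text \<open>Multiply by the constant 1, regarded as a polynomial of degree at most
  \<open>e - d\<close>.\<close>

lemma poly_functions_mono:
  assumes "f \<in> poly_functions n d" "d \<le> e"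
  shows "f \<in> poly_functions n e"
  using poly_functions_mult[OF assms(1) poly_functions_const[of 1 n "e - d"]] assms(2) by simp

lemma poly_functions_coordinate:
  assumes "l < n"
  shows "(\<lambda>x. Poly_Mapping.lookup x l - c) \<in> poly_functions n 1"
proof -
  have "monomial_eval (Poly_Mapping.single l 1) \<in> poly_functions n 1"
    using assms by (intro poly_functions_monomial_eval) (simp add: multiindices_def)
  from poly_functions_add[OF this poly_functions_const[of "- c"]] show ?thesis
    by (simp add: monomial_eval_single)
qed

text \<open>A translated monomial is a product of powers of affine coordinate functions, whose
  degrees add up to \<open>mdegree \<alpha>\<close>.\<close>

lemma poly_functions_shifted_monomial:
  assumes "\<alpha> \<in> multiindices n r"
  shows "(\<lambda>x. monomial_eval \<alpha> (x - a)) \<in> poly_functions n r"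
proof -
  have "(\<lambda>x. (Poly_Mapping.lookup x i - Poly_Mapping.lookup a i) ^ Poly_Mapping.lookup \<alpha> i)
      \<in> poly_functions n (Poly_Mapping.lookup \<alpha> i)" if "i \<in> Poly_Mapping.keys \<alpha>" for i
    using poly_functions_power[OF poly_functions_coordinate[of i n]] that assms
    by (auto simp: multiindices_def)
  from poly_functions_prod[OF this]
  have "(\<lambda>x. monomial_eval \<alpha> (x - a)) \<in> poly_functions n (mdegree \<alpha>)"
    by (simp add: monomial_eval_def lookup_minus mdegree_def)
  then show ?thesis
    using assms by (auto simp: multiindices_def intro: poly_functions_mono)
qed

section \<open>Order of vanishing\<close>

text \<open>Quantifying over all lists of directions makes the notion compatible with a partial
  derivative in any direction, which yields the recursion \<open>vanishes_Suc\<close>.\<close>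

definition vanishes :: "nat \<Rightarrow> (vec \<Rightarrow> real) \<Rightarrow> vec \<Rightarrow> bool" where
  "vanishes m f a \<longleftrightarrow> (\<forall>L. length L < m \<longrightarrow> iter_deriv L f a = 0)"

lemma vanishes_0 [simp]: "vanishes 0 f a"
  by (simp add: vanishes_def)

lemma vanishes_Suc: "vanishes (Suc m) f a \<longleftrightarrow> f a = 0 \<and> (\<forall>i. vanishes m (partial_deriv i f) a)"
proof safe
  assume f: "vanishes (Suc m) f a"
  then have "iter_deriv [] f a = 0" unfolding vanishes_def by (metis list.size(3) zero_less_Suc)
  then show "f a = 0" by simp
  fix i show "vanishes m (partial_deriv i f) a"
    using f unfolding vanishes_def by (simp flip: iter_deriv_snoc)
next
  assume f: "f a = 0" "\<forall>i. vanishes m (partial_deriv i f) a"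
  have "iter_deriv L f a = 0" if "length L < Suc m" for L
    using that f by (cases L rule: rev_cases) (auto simp: vanishes_def iter_deriv_snoc)
  then show "vanishes (Suc m) f a" by (simp add: vanishes_def)
qed

lemma vanishes_add:
  assumes "real_polynomial_function f" "real_polynomial_function g" "vanishes m f a" "vanishes m g a"
  shows "vanishes m (\<lambda>x. f x + g x) a"
  using assms by (simp add: vanishes_def iter_deriv_add)

text \<open>Orders of vanishing add. The form with \<open>t \<le> l + m\<close> suits induction on
  \<open>t\<close>: each term of the product rule lowers one of the two orders by at most
  one.\<close>

lemma vanishes_mult:
  assumes "real_polynomial_function f" "real_polynomial_function g"
    "vanishes l f a" "vanishes m g a" "t \<le> l + m"
  shows "vanishes t (\<lambda>x. f x * g x) a"
  using assms
proof (induction t arbitrary: f g l m)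
  case (Suc t)
  have "l > 0 \<Longrightarrow> f a = 0" "m > 0 \<Longrightarrow> g a = 0"
    using Suc.prems(3,4) by (metis gr0_implies_Suc vanishes_Suc)+
  with Suc.prems(5) have "f a * g a = 0" by (cases "l > 0") auto
  moreover have "vanishes t (partial_deriv i (\<lambda>x. f x * g x)) a" for i
  proof -
    \<comment> \<open>If one order is 0, truncated subtraction leaves it 0 and its claim is void;
      the other order is then at least \<open>Suc t\<close>, so the remaining sum still reaches
      \<open>t\<close>.\<close>
    have "vanishes (m - 1) (partial_deriv i g) a" "vanishes (l - 1) (partial_deriv i f) a"
      using Suc.prems(3,4) by (cases m; cases l; simp add: vanishes_Suc)+
    with Suc.prems have "vanishes t (\<lambda>x. f x * partial_deriv i g x) a"
      "vanishes t (\<lambda>x. partial_deriv i f x * g x) a"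
      using Suc.IH[of f "partial_deriv i g" l "m - 1"] Suc.IH[of "partial_deriv i f" g "l - 1" m]
      by (simp_all add: real_polynomial_function_partial_deriv)
    with Suc.prems show ?thesis
      by (auto simp: partial_deriv_mult
          intro!: vanishes_add real_polynomial_function.intros(4) real_polynomial_function_partial_deriv)
  qed
  ultimately show ?case by (simp add: vanishes_Suc)
qed simp

lemma vanishes_power:
  assumes "real_polynomial_function f" "vanishes 1 f a"
  shows "vanishes m (\<lambda>x. f x ^ m) a"
proof (induction m)
  case (Suc m)
  then show ?case
    using vanishes_mult[OF assms(1) real_polynomial_function_power[OF assms(1), of m] assms(2), of m "Suc m"]
    by simp
qed simp

text \<open>A list shorter than the degree cannot use up all exponents, so the derivative at 0 is
  zero; translation moves this to \<open>a\<close>.\<close>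

lemma vanishes_shifted_monomial: "vanishes (mdegree \<alpha>) (\<lambda>x. monomial_eval \<alpha> (x - a)) a"
proof -
  have "iter_deriv L (monomial_eval \<alpha>) 0 = 0" if "length L < mdegree \<alpha>" for L
    using that iter_deriv_monomial_eval_at_zero[of L \<alpha>] mdegree_list_index[of L] by auto
  then show ?thesis
    by (simp add: vanishes_def iter_deriv_shift)
qed

lemma real_polynomial_function_shift:
  assumes "real_polynomial_function f"
  shows "real_polynomial_function (\<lambda>x. f (x - a))"
proof -
  have "polynomial_function (\<lambda>x. x - a)" by (intro polynomial_function_diff) auto
  from real_polynomial_function_compose[OF this assms] show ?thesis by (simp add: o_def)
qed

lemma iter_deriv_mult_shifted_monomial:
  assumes P: "real_polynomial_function P" and L: "length L \<le> mdegree \<alpha>"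
  shows "iter_deriv L (\<lambda>x. P x * monomial_eval \<alpha> (x - a)) a = P a * iter_deriv L (monomial_eval \<alpha>) 0"
proof -
  let ?m = "\<lambda>x. monomial_eval \<alpha> (x - a)"
  have m: "real_polynomial_function ?m"
    by (intro real_polynomial_function_shift real_polynomial_function_monomial_eval)
  have P': "real_polynomial_function (\<lambda>x. P x - P a)"
    by (intro real_polynomial_function_diff P real_polynomial_function.intros(2))
  \<comment> \<open>\<open>P\<close> may be replaced by the constant \<open>P a\<close>: the error vanishes to order \<open>|\<alpha>| + 1\<close>.\<close>
  have "vanishes 1 (\<lambda>x. P x - P a) a" by (simp add: vanishes_def)
  then have "vanishes (1 + mdegree \<alpha>) (\<lambda>x. (P x - P a) * ?m x) a"
    using vanishes_mult[OF P' m _ vanishes_shifted_monomial] by blast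
  with L have "iter_deriv L (\<lambda>x. (P x - P a) * ?m x) a = 0"
    by (simp add: vanishes_def)
  moreover have "(\<lambda>x. P x * ?m x) = (\<lambda>x. (P x - P a) * ?m x + P a * ?m x)"
    by (simp add: algebra_simps)
  then have "iter_deriv L (\<lambda>x. P x * ?m x) =
      (\<lambda>x. iter_deriv L (\<lambda>x. (P x - P a) * ?m x) x + iter_deriv L (\<lambda>x. P a * ?m x) x)"
    using m P' by (simp only:) (intro iter_deriv_add real_polynomial_function.intros(2,4))
  ultimately show ?thesis
    using m by (simp add: iter_deriv_cmult iter_deriv_shift)
qed

section \<open>Hermite interpolation\<close>

text \<open>For each other point choose a coordinate in which it differs from \<open>u j\<close>.
  The product of the \<open>m\<close>-th powers of the corresponding affine functions has a zero of
  order \<open>m\<close> at each of these points and none at \<open>u j\<close>.\<close>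

lemma separating_polynomial:
  fixes u :: "nat \<Rightarrow> vec"
  assumes u: "inj_on u {..<k}" "\<And>i. i < k \<Longrightarrow> u i \<in> euclid n" and j: "j < k"
  shows "\<exists>P\<in>poly_functions n ((k - 1) * m). P (u j) \<noteq> 0 \<and> (\<forall>i<k. i \<noteq> j \<longrightarrow> vanishes m P (u i))"
proof -
  define S where "S = {..<k} - {j}"
  have "finite S" by (simp add: S_def)
  have "\<exists>l<n. Poly_Mapping.lookup (u i) l \<noteq> Poly_Mapping.lookup (u j) l" if "i \<in> S" for i
  proof -
    have "u i \<noteq> u j" using that u(1) j by (auto simp: S_def inj_on_def)
    then obtain l where l: "Poly_Mapping.lookup (u i) l \<noteq> Poly_Mapping.lookup (u j) l"
      by (metis poly_mapping_eqI)
    \<comment> \<open>Coordinates of index at least \<open>n\<close> are zero for both points, so a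
      difference can only occur below \<open>n\<close>.\<close>
    then have "l \<in> Poly_Mapping.keys (u i) \<union> Poly_Mapping.keys (u j)" by (auto simp: in_keys_iff)
    with u(2)[of i] u(2)[of j] that j have "l < n" by (auto simp: euclid_def S_def)
    with l show ?thesis by blast
  qed
  then obtain l where l: "\<And>i. i \<in> S \<Longrightarrow> l i < n"
    "\<And>i. i \<in> S \<Longrightarrow> Poly_Mapping.lookup (u i) (l i) \<noteq> Poly_Mapping.lookup (u j) (l i)"
    by metis
  define h where "h i = (\<lambda>x. Poly_Mapping.lookup x (l i) - Poly_Mapping.lookup (u i) (l i))" for i
  define P where "P = (\<lambda>x. \<Prod>i\<in>S. h i x ^ m)"
  have h: "h i \<in> poly_functions n 1" if "i \<in> S" for i
    unfolding h_def by (rule poly_functions_coordinate[OF l(1)[OF that]])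
  have rpf: "real_polynomial_function (h i)" if "i \<in> S" for i
    by (rule real_polynomial_function_poly_functions[OF h[OF that]])
  have "(\<lambda>x. h i x ^ m) \<in> poly_functions n m" if "i \<in> S" for i
    using poly_functions_power[OF h[OF that], of m] by simp
  then have "P \<in> poly_functions n (\<Sum>i\<in>S. m)"
    unfolding P_def by (rule poly_functions_prod)
  moreover have "card S = k - 1"
    using j by (simp add: S_def)
  ultimately have "P \<in> poly_functions n ((k - 1) * m)"
    by simp
  moreover have "P (u j) \<noteq> 0"
    using l(2) \<open>finite S\<close> by (force simp: P_def h_def)
  moreover have "vanishes m P (u i)" if i: "i < k" "i \<noteq> j" for i
  proof -
    have iS: "i \<in> S" using i by (auto simp: S_def)
    \<comment> \<open>The factor belonging to \<open>i\<close> alone supplies the order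
      \<open>m\<close>; the rest of the product enters with order 0.\<close>
    with \<open>finite S\<close> have "P = (\<lambda>x. h i x ^ m * (\<Prod>i\<in>S - {i}. h i x ^ m))"
      unfolding P_def by (intro ext prod.remove)
    moreover have "vanishes 1 (h i) (u i)"
      by (simp add: vanishes_def h_def)
    then have "vanishes m (\<lambda>x. h i x ^ m) (u i)"
      by (rule vanishes_power[OF rpf[OF iS]])
    then have "vanishes m (\<lambda>x. h i x ^ m * (\<Prod>i\<in>S - {i}. h i x ^ m)) (u i)"
      using \<open>finite S\<close>
      by (intro vanishes_mult[where l = m and m = 0] real_polynomial_function_prod
          real_polynomial_function_power rpf iS) auto
    ultimately show ?thesis by simp
  qed
  ultimately show ?thesis by blast
qed

text \<open>These functions are dual to the functionals
  \<open>f \<mapsto> mpartial \<beta> f (u i)\<close>. At \<open>u j\<close> the system is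
  triangular with respect to degree, so it is solved from the top degree downwards.\<close>

lemma hermite_basis:
  fixes u :: "nat \<Rightarrow> vec"
  assumes u: "inj_on u {..<k}" "\<And>i. i < k \<Longrightarrow> u i \<in> euclid n" and j: "j < k"
    and \<alpha>: "\<alpha> \<in> multiindices n r"
  shows "\<exists>f\<in>poly_functions n ((r + 1) * k). \<forall>i<k. \<forall>\<beta>\<in>multiindices n r.
    mpartial \<beta> f (u i) = (if i = j \<and> \<beta> = \<alpha> then 1 else 0)"
  using \<alpha>
\<comment> \<open>Degrees are bounded by \<open>r\<close>, so a higher degree means a strictly
  smaller measure: the induction hypothesis supplies the functions for all indices above the degree
  of \<alpha>.\<close>
proof (induction "r - mdegree \<alpha>" arbitrary: \<alpha> rule: less_induct)
  case less
  note rpf = real_polynomial_function_poly_functions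
  obtain P where P: "P \<in> poly_functions n ((k - 1) * (r + 1))" "P (u j) \<noteq> 0"
    "\<And>i. i < k \<Longrightarrow> i \<noteq> j \<Longrightarrow> vanishes (r + 1) P (u i)"
    using separating_polynomial[OF u j, of "r + 1"] by blast
  define g where "g = (\<lambda>x. P x * monomial_eval \<alpha> (x - u j))"
  have mon: "(\<lambda>x. monomial_eval \<alpha> (x - u j)) \<in> poly_functions n r"
    by (rule poly_functions_shifted_monomial[OF less.prems])
  \<comment> \<open>Degree budget: each of the \<open>k - 1\<close> other points costs
    \<open>r + 1\<close>, and the shifted monomial costs at most \<open>r\<close>.\<close>
  have "(k - 1) * (r + 1) + r \<le> (r + 1) * k"
    using j by (cases k) auto
  then have g: "g \<in> poly_functions n ((r + 1) * k)"
    unfolding g_def by (rule poly_functions_mono[OF poly_functions_mult[OF P(1) mon]])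
  have g_other: "mpartial \<beta> g (u i) = 0" if "i < k" "i \<noteq> j" "\<beta> \<in> multiindices n r" for i \<beta>
  proof -
    have "vanishes (r + 1) g (u i)"
      unfolding g_def using vanishes_mult[OF rpf[OF P(1)] rpf[OF mon] P(3)[OF that(1,2)] vanishes_0]
      by simp
    with that(3) show ?thesis
      by (simp add: vanishes_def mpartial_eq_iter_deriv length_deriv_list multiindices_def)
  qed
  have g_low: "mpartial \<beta> g (u j) \<noteq> 0 \<longleftrightarrow> \<beta> = \<alpha>" if "mdegree \<beta> \<le> mdegree \<alpha>" for \<beta>
    using iter_deriv_mult_shifted_monomial[OF rpf[OF P(1)], of "deriv_list \<beta>" \<alpha> "u j"] that P(2)
      iter_deriv_monomial_eval_at_zero[of "deriv_list \<beta>" \<alpha>]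
    by (simp add: g_def mpartial_eq_iter_deriv length_deriv_list list_index_deriv_list)
  \<comment> \<open>The indices at which the derivatives of \<open>g\<close> at \<open>u j\<close>
    are uncontrolled.\<close>
  define H where "H = {\<gamma>\<in>multiindices n r. mdegree \<alpha> < mdegree \<gamma>}"
  have "finite H" by (simp add: H_def finite_multiindices)
  have "\<exists>f\<in>poly_functions n ((r + 1) * k). \<forall>i<k. \<forall>\<beta>\<in>multiindices n r.
      mpartial \<beta> f (u i) = (if i = j \<and> \<beta> = \<gamma> then 1 else 0)" if "\<gamma> \<in> H" for \<gamma>
    using that by (intro less.hyps) (auto simp: H_def multiindices_def)
  then obtain e where e: "\<And>\<gamma>. \<gamma> \<in> H \<Longrightarrow> e \<gamma> \<in> poly_functions n ((r + 1) * k)"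
    "\<And>\<gamma> i \<beta>. \<gamma> \<in> H \<Longrightarrow> i < k \<Longrightarrow> \<beta> \<in> multiindices n r \<Longrightarrow>
      mpartial \<beta> (e \<gamma>) (u i) = (if i = j \<and> \<beta> = \<gamma> then 1 else 0)"
    by metis
  define c where "c = mpartial \<alpha> g (u j)"
  have c: "c \<noteq> 0" using g_low[of \<alpha>] by (simp add: c_def)
  \<comment> \<open>Among the derivatives considered, \<open>e \<gamma>\<close> affects only that of
    index \<gamma> at \<open>u j\<close>. These coefficients therefore cancel the unwanted values
    independently and preserve both \<open>c\<close> and the zeros at the other points.\<close>
  define b where "b \<gamma> = - mpartial \<gamma> g (u j)" for \<gamma>
  define h where "h = (\<lambda>x. \<Sum>\<gamma>\<in>H. b \<gamma> * e \<gamma> x)"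
  have h: "h \<in> poly_functions n ((r + 1) * k)"
    unfolding h_def using e(1) by (intro poly_functions_sum poly_functions_cmult)
  have mh: "mpartial \<beta> h (u i) = (if i = j \<and> \<beta> \<in> H then b \<beta> else 0)"
    if "i < k" "\<beta> \<in> multiindices n r" for i \<beta>
  proof -
    have "mpartial \<beta> h (u i) = (\<Sum>\<gamma>\<in>H. mpartial \<beta> (\<lambda>x. b \<gamma> * e \<gamma> x) (u i))"
      unfolding h_def mpartial_eq_iter_deriv[of \<beta>] using e(1) \<open>finite H\<close>
      by (subst iter_deriv_sum) (auto intro!: real_polynomial_function.intros(2,4) rpf[OF e(1)])
    also have "\<dots> = (\<Sum>\<gamma>\<in>H. b \<gamma> * mpartial \<beta> (e \<gamma>) (u i))"
      unfolding mpartial_eq_iter_deriv[of \<beta>] using e(1)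
      by (intro sum.cong refl) (subst iter_deriv_cmult, auto intro: rpf[OF e(1)])
    also have "\<dots> = (\<Sum>\<gamma>\<in>H. if \<gamma> = \<beta> then (if i = j then b \<beta> else 0) else 0)"
      using e(2)[OF _ that] by (intro sum.cong) auto
    also have "\<dots> = (if i = j \<and> \<beta> \<in> H then b \<beta> else 0)"
      using \<open>finite H\<close> by simp
    finally show ?thesis .
  qed
  define f where "f = (\<lambda>x. (1 / c) * (g x + h x))"
  have "f \<in> poly_functions n ((r + 1) * k)"
    unfolding f_def by (intro poly_functions_cmult poly_functions_add g h)
  moreover have "mpartial \<beta> f (u i) = (if i = j \<and> \<beta> = \<alpha> then 1 else 0)"
    if i: "i < k" and \<beta>: "\<beta> \<in> multiindices n r" for i \<beta>
  proof -
    have "mpartial \<beta> f (u i) = (1 / c) * (mpartial \<beta> g (u i) + mpartial \<beta> h (u i))"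
      unfolding f_def mpartial_eq_iter_deriv
      by (simp only: iter_deriv_cmult[OF real_polynomial_function.intros(3)[OF rpf[OF g] rpf[OF h]]]
          iter_deriv_add[OF rpf[OF g] rpf[OF h]])
    also have "\<dots> = (if i = j \<and> \<beta> = \<alpha> then 1 else 0)"
    proof (cases "i = j")
      case True
      show ?thesis
      proof (cases "\<beta> \<in> H")
        case True
        then show ?thesis
          using \<open>i = j\<close> mh[OF i \<beta>] by (auto simp: H_def b_def)
      next
        case False
        with \<beta> have "mdegree \<beta> \<le> mdegree \<alpha>" by (auto simp: H_def)
        with False show ?thesis
          using \<open>i = j\<close> mh[OF i \<beta>] g_low[of \<beta>] c by (auto simp: c_def)
      qed
    next
      case False
      then show ?thesis using g_other[OF i False \<beta>] mh[OF i \<beta>] by simp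
    qed
    finally show ?thesis .
  qed
  ultimately show ?case by blast
qed

lemma mpartial_poly_eval:
  assumes "p \<in> polys n d"
  shows "mpartial \<beta> (poly_eval p) =
    (\<lambda>x. \<Sum>\<alpha>\<in>multiindices n d. Poly_Mapping.lookup p \<alpha> * mpartial \<beta> (monomial_eval \<alpha>) x)"
  unfolding poly_eval_polys[OF assms] mpartial_eq_iter_deriv
  by (subst iter_deriv_sum)
     (auto simp: iter_deriv_cmult real_polynomial_function_monomial_eval finite_multiindices
       intro!: real_polynomial_function.intros(2,4))

text \<open>The prescribed values are themselves the coefficients with respect to the dual basis;
  membership in \<open>poly_functions\<close> then returns a coefficient family
  \<open>q\<close>.\<close>

lemma hermite_interpolation:
  fixes u :: "nat \<Rightarrow> vec" and z :: "nat \<Rightarrow> multiindex \<Rightarrow> real"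
  assumes u: "inj_on u {..<k}" "\<And>i. i < k \<Longrightarrow> u i \<in> euclid n" and d: "(r + 1) * k \<le> d"
  shows "\<exists>q\<in>polys n d. \<forall>i<k. \<forall>\<beta>\<in>multiindices n r. mpartial \<beta> (poly_eval q) (u i) = z i \<beta>"
proof -
  define I where "I = {..<k} \<times> multiindices n r"
  have I: "finite I" by (simp add: I_def finite_multiindices)
  have "\<exists>f\<in>poly_functions n ((r + 1) * k). \<forall>i<k. \<forall>\<beta>\<in>multiindices n r.
      mpartial \<beta> f (u i) = (if (i, \<beta>) = s then 1 else 0)" if "s \<in> I" for s
    using hermite_basis[OF u, of "fst s" "snd s"] that
    by (cases s) (simp add: I_def)
  then obtain e where e: "\<And>s. s \<in> I \<Longrightarrow> e s \<in> poly_functions n ((r + 1) * k)"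
    "\<And>s i \<beta>. s \<in> I \<Longrightarrow> i < k \<Longrightarrow> \<beta> \<in> multiindices n r \<Longrightarrow>
      mpartial \<beta> (e s) (u i) = (if (i, \<beta>) = s then 1 else 0)"
    by metis
  note rpf = real_polynomial_function_poly_functions[OF e(1)]
  define f where "f = (\<lambda>x. \<Sum>s\<in>I. case_prod z s * e s x)"
  have "f \<in> poly_functions n ((r + 1) * k)"
    unfolding f_def by (intro poly_functions_sum poly_functions_cmult e(1))
  then have "f \<in> poly_functions n d" by (rule poly_functions_mono[OF _ d])
  then obtain q where q: "q \<in> polys n d" "f = poly_eval q"
    by (auto simp: poly_functions_def)
  moreover have "mpartial \<beta> f (u i) = z i \<beta>" if "i < k" "\<beta> \<in> multiindices n r" for i \<beta>
  proof -
    have "mpartial \<beta> f (u i) = (\<Sum>s\<in>I. mpartial \<beta> (\<lambda>x. case_prod z s * e s x) (u i))"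
      unfolding f_def mpartial_eq_iter_deriv using I
      by (subst iter_deriv_sum) (auto intro!: real_polynomial_function.intros(2,4) rpf)
    also have "\<dots> = (\<Sum>s\<in>I. case_prod z s * mpartial \<beta> (e s) (u i))"
      unfolding mpartial_eq_iter_deriv
      by (intro sum.cong refl) (subst iter_deriv_cmult, auto intro: rpf)
    also have "\<dots> = (\<Sum>s\<in>I. if s = (i, \<beta>) then z i \<beta> else 0)"
      using e(2)[OF _ that] by (intro sum.cong) auto
    also have "\<dots> = z i \<beta>"
      using I that by (simp add: I_def)
    finally show ?thesis .
  qed
  ultimately show ?thesis by blast
qed

section \<open>Vector-valued polynomial maps are smooth\<close>

text \<open>Finite sums of scalar polynomials times fixed vectors. The values span a
  finite-dimensional subspace even when the codomain is infinite-dimensional, so differentiation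
  reduces to the scalar case.\<close>

inductive vector_polynomial :: "('a::real_normed_vector \<Rightarrow> 'b::real_normed_vector) \<Rightarrow> bool" where
  scale: "real_polynomial_function g \<Longrightarrow> vector_polynomial (\<lambda>x. g x *\<^sub>R w)"
| add: "vector_polynomial F \<Longrightarrow> vector_polynomial G \<Longrightarrow> vector_polynomial (\<lambda>x. F x + G x)"

lemma vector_polynomial_sum:
  assumes "\<And>s. s \<in> S \<Longrightarrow> vector_polynomial (F s)"
  shows "vector_polynomial (\<lambda>x. \<Sum>s\<in>S. F s x)"
proof -
  have zero: "vector_polynomial (\<lambda>x. 0)"
    using vector_polynomial.scale[OF real_polynomial_function.intros(2), of _ 0] by simp
  show ?thesis
  proof (cases "finite S")
    case True
    then show ?thesis
      using assms by (induction S) (auto simp: zero intro: vector_polynomial.add)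
  qed (simp add: zero)
qed

lemma vector_polynomial_bounded_linear_compose:
  assumes L: "bounded_linear L" and F: "vector_polynomial F"
  shows "vector_polynomial (\<lambda>x. L (F x))"
proof -
  interpret L: bounded_linear L by fact
  show ?thesis
    using F by induction (simp_all add: L.scaleR L.add vector_polynomial.intros)
qed

lemma vector_polynomial_single:
  assumes "real_polynomial_function g"
  shows "vector_polynomial (\<lambda>x. Poly_Mapping.single i (g x))"
  using vector_polynomial.scale[OF assms, of "Poly_Mapping.single i (1::real)"]
  by (simp add: scaleR_single)

lemma vector_polynomial_Pair:
  assumes "vector_polynomial F" "vector_polynomial G"
  shows "vector_polynomial (\<lambda>x. (F x, G x))"
proof -
  have "bounded_linear (\<lambda>a. (a, 0))" "bounded_linear (\<lambda>b. (0, b))"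
    by (auto intro!: bounded_linear_Pair bounded_linear_ident bounded_linear_zero)
  from vector_polynomial.add[OF vector_polynomial_bounded_linear_compose[OF this(1) assms(1)]
      vector_polynomial_bounded_linear_compose[OF this(2) assms(2)]]
  show ?thesis by simp
qed

lemma vector_polynomial_has_derivative:
  assumes "vector_polynomial F"
  shows "\<exists>F'. (\<forall>x. (F has_derivative F' x) (at x)) \<and> (\<forall>v. vector_polynomial (\<lambda>x. F' x v))"
  using assms
proof induction
  case (scale g w)
  then obtain g' where "\<And>x. (g has_derivative g' x) (at x)" "\<And>v. real_polynomial_function (\<lambda>x. g' x v)"
    using real_polynomial_function_has_derivative by blast
  then show ?case
    by (intro exI[of _ "\<lambda>x v. g' x v *\<^sub>R w"])
       (auto intro: has_derivative_scaleR_left vector_polynomial.scale)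
next
  case (add F G)
  obtain F' where "\<forall>x. (F has_derivative F' x) (at x)" "\<forall>v. vector_polynomial (\<lambda>x. F' x v)"
    using add.IH(1) by (elim exE conjE)
  moreover obtain G' where "\<forall>x. (G has_derivative G' x) (at x)" "\<forall>v. vector_polynomial (\<lambda>x. G' x v)"
    using add.IH(2) by (elim exE conjE)
  ultimately show ?case
    by (intro exI[of _ "\<lambda>x v. F' x v + G' x v"])
       (auto intro: has_derivative_add vector_polynomial.add)
qed

text \<open>The class is closed under directional derivatives, so induction on \<open>m\<close>
  applies. The derivatives exist on the whole ambient space and are merely restricted to
  \<open>M\<close>.\<close>

lemma vector_polynomial_Ck_on:
  "vector_polynomial F \<Longrightarrow> Ck_on m V M F"
proof (induction m arbitrary: F)
  case 0
  then obtain F' where "\<forall>x. (F has_derivative F' x) (at x)"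
    using vector_polynomial_has_derivative by blast
  then have "\<forall>x\<in>M. isCont F x"
    using has_derivative_continuous by blast
  then show ?case
    by (simp add: continuous_at_imp_continuous_on)
next
  case (Suc m)
  then obtain F' where F': "\<And>x. (F has_derivative F' x) (at x)" "\<And>v. vector_polynomial (\<lambda>x. F' x v)"
    using vector_polynomial_has_derivative by blast
  show ?case
    unfolding Ck_on.simps
    by (intro exI[of _ F'] conjI ballI has_derivative_at_withinI[OF F'(1)] Suc.IH[OF F'(2)])
qed

text \<open>Only the top level mentions the function itself: a derivative of \<open>f\<close> within
  \<open>M\<close> also serves \<open>g\<close>, and all deeper conditions concern that derivative.
  Hence a case distinction instead of an induction.\<close>

lemma Ck_on_cong:
  assumes "Ck_on m V M f" "\<And>x. x \<in> M \<Longrightarrow> g x = f x"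
  shows "Ck_on m V M g"
proof (cases m)
  case 0
  then show ?thesis using assms continuous_on_cong[of M M g f] by simp
next
  case (Suc l)
  with assms(1) obtain f' where f': "\<And>x. x \<in> M \<Longrightarrow> (f has_derivative f' x) (at x within M)"
    "\<And>v. v \<in> V \<Longrightarrow> Ck_on l V M (\<lambda>x. f' x v)"
    by auto
  have "(g has_derivative f' x) (at x within M)" if "x \<in> M" for x
    using that assms(2) f'(1)[OF that] by (rule has_derivative_transform)
  with Suc f'(2) show ?thesis by auto
qed

section \<open>The source and target spaces\<close>

lemma euclid_iff: "x \<in> euclid n \<longleftrightarrow> (\<forall>i\<ge>n. Poly_Mapping.lookup x i = 0)"
  by (auto simp: euclid_def in_keys_iff subset_iff simp flip: not_less)

lemma tuples_iff:
  "u \<in> tuples k S \<longleftrightarrow> (\<forall>j\<ge>k. Poly_Mapping.lookup u j = 0) \<and> (\<forall>j<k. Poly_Mapping.lookup u j \<in> S)"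
  by (auto simp: tuples_def in_keys_iff subset_iff simp flip: not_less)

lemma jet_space_eq: "jet_space n r = euclid n \<times> polys n r"
  by (simp add: jet_space_def span_hom_polys)

lemma subspace_polys: "subspace (polys n d)"
  unfolding span_hom_polys[symmetric] by (rule subspace_span)

lemma subspace_euclid: "subspace (euclid n)"
  by (auto simp: subspace_def euclid_iff lookup_add)

lemma subspace_tuples: "subspace S \<Longrightarrow> subspace (tuples k S)"
  by (auto simp: subspace_def tuples_iff lookup_add)

lemma tuples_sum_single:
  assumes "\<And>j. j < k \<Longrightarrow> f j \<in> S"
  shows "(\<Sum>j<k. Poly_Mapping.single j (f j)) \<in> tuples k S"
  using assms by (simp add: tuples_iff lookup_sum_single)

text \<open>Pairwise distinctness is a finite conjunction of open conditions, each comparing two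
  continuous coordinates.\<close>

lemma openin_configs: "openin (top_of_set (tuples k (euclid n))) (configs n k)"
proof -
  let ?U = "\<Inter>i\<in>{..<k}. \<Inter>j\<in>{..<k} - {i}.
    {u :: nat \<Rightarrow>\<^sub>0 vec. Poly_Mapping.lookup u i \<noteq> Poly_Mapping.lookup u j}"
  have "open ?U"
    by (intro open_INT ballI finite_lessThan finite_Diff open_Collect_neq
        linear_continuous_on bounded_linear_lookup)
  moreover have "configs n k = tuples k (euclid n) \<inter> ?U"
    by (auto simp: configs_def inj_on_def)
  ultimately show ?thesis by (auto simp: openin_open)
qed

section \<open>The truncated multijet map\<close>

text \<open>On a line along which \<open>f\<close> is affine, the slope determines any derivative in
  that direction. This identifies an abstractly obtained derivative in directions that change only
  the polynomial.\<close>

lemma has_derivative_direction_unique: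
  fixes f :: "'a::real_normed_vector \<Rightarrow> real"
  assumes f: "(f has_derivative f') (at x)" and aff: "\<And>t. f (x + t *\<^sub>R v) = f x + t * c"
  shows "f' v = c"
proof -
  interpret bounded_linear f' using f by (rule has_derivative_bounded_linear)
  have "((\<lambda>t. x + t *\<^sub>R v) has_derivative (\<lambda>t. t *\<^sub>R v)) (at 0)"
    by (auto intro!: derivative_eq_intros)
  moreover have "(f has_derivative f') (at (x + 0 *\<^sub>R v))"
    using f by simp
  ultimately have "((\<lambda>t. f (x + t *\<^sub>R v)) has_derivative (\<lambda>t. f' (t *\<^sub>R v))) (at 0)"
    by (rule has_derivative_compose)
  moreover have "(\<lambda>t. f' (t *\<^sub>R v)) = (*) (f' v)"
    by (simp add: scaleR mult.commute fun_eq_iff)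
  ultimately have "((\<lambda>t. f (x + t *\<^sub>R v)) has_field_derivative f' v) (at 0)"
    by (simp add: has_field_derivative_def)
  moreover have "((\<lambda>t. f (x + t *\<^sub>R v)) has_field_derivative c) (at 0)"
    unfolding aff by (auto intro!: derivative_eq_intros)
  ultimately show ?thesis by (rule DERIV_unique)
qed

text \<open>
  On the infinite-dimensional space of all polynomials with the norm of \<open>poly_fn\<close>, \<open>p \<mapsto> \<partial>\<^sup>\<alpha> p (x)\<close> is
  discontinuous in general. Ignoring the coefficients of degree above \<open>d\<close> makes it bounded without changing
  it on \<open>polys n d\<close>.
\<close>

definition trunc_partial :: "nat \<Rightarrow> nat \<Rightarrow> nat \<Rightarrow> multiindex \<Rightarrow> poly_fn \<times> (nat \<Rightarrow>\<^sub>0 vec) \<Rightarrow> real" where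
  "trunc_partial n d j \<alpha> x = (\<Sum>\<beta>\<in>multiindices n d. Poly_Mapping.lookup (fst x) \<beta> *
     mpartial \<alpha> (monomial_eval \<beta>) (Poly_Mapping.lookup (snd x) j))"

text \<open>Builds a multijet from the coordinates \<open>a\<close> of its base points and the
  derivative values \<open>b\<close>. Being linear in the pair, it describes both the multijet map
  and its differential.\<close>

definition assemble ::
  "nat \<Rightarrow> nat \<Rightarrow> nat \<Rightarrow> (nat \<Rightarrow> nat \<Rightarrow> real) \<Rightarrow> (nat \<Rightarrow> multiindex \<Rightarrow> real) \<Rightarrow> (nat \<Rightarrow>\<^sub>0 jet)" where
  "assemble n k r a b = (\<Sum>j<k. Poly_Mapping.single j
     (\<Sum>l<n. Poly_Mapping.single l (a j l), \<Sum>\<alpha>\<in>multiindices n r. Poly_Mapping.single \<alpha> (b j \<alpha>)))"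

lemma assemble_mem: "assemble n k r a b \<in> multijet_space n k r"
  unfolding assemble_def multijet_space_def jet_space_eq
proof (rule tuples_sum_single, rule SigmaI)
  show "(\<Sum>l<n. Poly_Mapping.single l (a j l)) \<in> euclid n" for j
    by (simp add: euclid_iff lookup_sum_single)
  show "(\<Sum>\<alpha>\<in>multiindices n r. Poly_Mapping.single \<alpha> (b j \<alpha>)) \<in> polys n r" for j
    by (auto simp: polys_def in_keys_iff lookup_sum_single finite_multiindices split: if_splits)
qed

lemma assemble_coordinates:
  assumes "w \<in> multijet_space n k r"
  shows "assemble n k r (\<lambda>j. Poly_Mapping.lookup (fst (Poly_Mapping.lookup w j)))
    (\<lambda>j. Poly_Mapping.lookup (snd (Poly_Mapping.lookup w j))) = w"
proof -
  have w: "w \<in> tuples k (euclid n \<times> polys n r)"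
    using assms by (simp add: multijet_space_def jet_space_eq)
  have "(\<Sum>l<n. Poly_Mapping.single l (Poly_Mapping.lookup (fst (Poly_Mapping.lookup w j)) l),
      \<Sum>\<alpha>\<in>multiindices n r. Poly_Mapping.single \<alpha> (Poly_Mapping.lookup (snd (Poly_Mapping.lookup w j)) \<alpha>))
      = Poly_Mapping.lookup w j" if "j < k" for j
  proof -
    have "Poly_Mapping.lookup w j \<in> euclid n \<times> polys n r"
      using w that by (simp add: tuples_def)
    then show ?thesis
      by (cases "Poly_Mapping.lookup w j")
         (simp add: euclid_def polys_def sum_single_lookup finite_multiindices)
  qed
  then have "assemble n k r (\<lambda>j. Poly_Mapping.lookup (fst (Poly_Mapping.lookup w j)))
      (\<lambda>j. Poly_Mapping.lookup (snd (Poly_Mapping.lookup w j)))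
      = (\<Sum>j<k. Poly_Mapping.single j (Poly_Mapping.lookup w j))"
    by (simp add: assemble_def)
  also have "\<dots> = w"
    using w by (intro sum_single_lookup) (auto simp: tuples_def)
  finally show ?thesis .
qed

text \<open>Agrees with the multijet map on the domain of the theorem but is polynomial on the whole
  ambient space, where ordinary derivatives can be taken.\<close>

definition trunc_multijet ::
  "nat \<Rightarrow> nat \<Rightarrow> nat \<Rightarrow> nat \<Rightarrow> poly_fn \<times> (nat \<Rightarrow>\<^sub>0 vec) \<Rightarrow> (nat \<Rightarrow>\<^sub>0 jet)" where
  "trunc_multijet n k r d x = assemble n k r
     (\<lambda>j. Poly_Mapping.lookup (Poly_Mapping.lookup (snd x) j)) (\<lambda>j \<alpha>. trunc_partial n d j \<alpha> x)"

lemma trunc_partial_eq: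
  "p \<in> polys n d \<Longrightarrow> trunc_partial n d j \<alpha> (p, u) = mpartial \<alpha> (poly_eval p) (Poly_Mapping.lookup u j)"
  by (simp add: trunc_partial_def mpartial_poly_eval)

lemma multijet_eq_trunc_multijet:
  assumes "p \<in> polys n d" "u \<in> configs n k"
  shows "multijet n k r (poly_eval p) u = trunc_multijet n k r d (p, u)"
proof -
  have "(\<Sum>l<n. Poly_Mapping.single l (Poly_Mapping.lookup (Poly_Mapping.lookup u j) l)) =
      Poly_Mapping.lookup u j" if "j < k" for j
    using assms(2) that by (intro sum_single_lookup) (auto simp: configs_def tuples_def euclid_def)
  then show ?thesis
    by (simp add: multijet_def jet_def trunc_multijet_def assemble_def trunc_partial_eq[OF assms(1)])
qed

section \<open>Regularity of the truncated map and its differential\<close>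

lemma bounded_linear_lookup_fst:
  "bounded_linear (\<lambda>x :: ('a \<Rightarrow>\<^sub>0 'b::real_normed_vector) \<times> 'c::real_normed_vector. Poly_Mapping.lookup (fst x) i)"
  by (rule bounded_linear_compose[OF bounded_linear_lookup bounded_linear_fst])

lemma bounded_linear_lookup_snd:
  "bounded_linear (\<lambda>x :: 'c::real_normed_vector \<times> ('a \<Rightarrow>\<^sub>0 'b::real_normed_vector). Poly_Mapping.lookup (snd x) i)"
  by (rule bounded_linear_compose[OF bounded_linear_lookup bounded_linear_snd])

lemma bounded_linear_lookup_lookup_snd:
  "bounded_linear (\<lambda>x :: 'c::real_normed_vector \<times> ('a \<Rightarrow>\<^sub>0 'd \<Rightarrow>\<^sub>0 'b::real_normed_vector).
     Poly_Mapping.lookup (Poly_Mapping.lookup (snd x) i) l)"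
  by (rule bounded_linear_compose[OF bounded_linear_lookup bounded_linear_lookup_snd])

lemma real_polynomial_function_trunc_partial: "real_polynomial_function (trunc_partial n d j \<alpha>)"
  unfolding trunc_partial_def[abs_def] mpartial_eq_iter_deriv
  by (rule real_polynomial_function_sum[OF finite_multiindices], rule real_polynomial_function.intros(4),
      rule real_polynomial_function.intros(1)[OF bounded_linear_lookup_fst],
      rule real_polynomial_function_bounded_linear_compose[OF _ bounded_linear_lookup_snd],
      rule real_polynomial_function_iter_deriv[OF real_polynomial_function_monomial_eval])

lemma vector_polynomial_trunc_multijet: "vector_polynomial (trunc_multijet n k r d)"
  unfolding trunc_multijet_def[abs_def] assemble_def
  by (rule vector_polynomial_sum, rule vector_polynomial_bounded_linear_compose[OF bounded_linear_single],
      rule vector_polynomial_Pair; rule vector_polynomial_sum, rule vector_polynomial_single,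
      rule real_polynomial_function_trunc_partial
      real_polynomial_function.intros(1)[OF bounded_linear_lookup_lookup_snd])

lemma trunc_multijet_has_derivative:
  assumes "\<And>j \<alpha>. (trunc_partial n d j \<alpha> has_derivative c' j \<alpha>) (at x)"
  shows "(trunc_multijet n k r d has_derivative
    (\<lambda>h. assemble n k r (\<lambda>j. Poly_Mapping.lookup (Poly_Mapping.lookup (snd h) j)) (\<lambda>j \<alpha>. c' j \<alpha> h))) (at x)"
  unfolding trunc_multijet_def[abs_def] assemble_def
  by (rule has_derivative_sum, rule bounded_linear.has_derivative[OF bounded_linear_single],
      rule has_derivative_Pair; rule has_derivative_sum,
      rule bounded_linear.has_derivative[OF bounded_linear_single],
      rule assms bounded_linear_imp_has_derivative[OF bounded_linear_lookup_lookup_snd])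

text \<open>The differential is block triangular: its base-point part is \<open>v\<close> alone, its
  jet part is the jet of \<open>q\<close> plus a contribution of \<open>v\<close>. So the target
  fixes \<open>v\<close>, and \<open>q\<close> supplies the remainder.\<close>

lemma trunc_multijet_derivative_surjective:
  assumes p: "p \<in> polys n d" and u: "u \<in> configs n k" and d: "(r + 1) * k \<le> d"
  shows "\<exists>f'. (trunc_multijet n k r d has_derivative f') (at (p, u)) \<and>
    f' ` (polys n d \<times> tuples k (euclid n)) = multijet_space n k r"
proof -
  have "\<exists>c'. (trunc_partial n d j \<alpha> has_derivative c') (at (p, u))" for j \<alpha>
    using real_polynomial_function_has_derivative[OF real_polynomial_function_trunc_partial] by blast
  then obtain c' where c': "\<And>j \<alpha>. (trunc_partial n d j \<alpha> has_derivative c' j \<alpha>) (at (p, u))"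
    by metis
  let ?f' = "\<lambda>h. assemble n k r (\<lambda>j. Poly_Mapping.lookup (Poly_Mapping.lookup (snd h) j)) (\<lambda>j \<alpha>. c' j \<alpha> h)"
  \<comment> \<open>\<open>trunc_partial\<close> is linear in the polynomial, hence affine along the
    direction \<open>(q, 0)\<close>.\<close>
  have c'_poly: "c' j \<alpha> (q, 0) = trunc_partial n d j \<alpha> (q, u)" for j \<alpha> q
    by (rule has_derivative_direction_unique[OF c'])
       (simp add: trunc_partial_def lookup_add distrib_right sum.distrib sum_distrib_left mult.assoc)
  have "w \<in> ?f' ` (polys n d \<times> tuples k (euclid n))" if w: "w \<in> multijet_space n k r" for w
  proof -
    define v where "v = (\<Sum>j<k. Poly_Mapping.single j (fst (Poly_Mapping.lookup w j)))"
    have v: "v \<in> tuples k (euclid n)"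
      unfolding v_def using w
      by (intro tuples_sum_single) (auto simp: multijet_space_def jet_space_eq tuples_def mem_Times_iff)
    \<comment> \<open>The subtracted term is the change of the derivatives caused by moving the base
      points along \<open>v\<close>; what is left is pure interpolation data at the fixed points of
      \<open>u\<close>.\<close>
    have "\<exists>q\<in>polys n d. \<forall>j<k. \<forall>\<alpha>\<in>multiindices n r.
        mpartial \<alpha> (poly_eval q) (Poly_Mapping.lookup u j) =
        Poly_Mapping.lookup (snd (Poly_Mapping.lookup w j)) \<alpha> - c' j \<alpha> (0, v)"
      using u by (intro hermite_interpolation d) (auto simp: configs_def tuples_def)
    then obtain q where q: "q \<in> polys n d"
      "\<forall>j<k. \<forall>\<alpha>\<in>multiindices n r. mpartial \<alpha> (poly_eval q) (Poly_Mapping.lookup u j) =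
        Poly_Mapping.lookup (snd (Poly_Mapping.lookup w j)) \<alpha> - c' j \<alpha> (0, v)"
      by (elim bexE)
    have "c' j \<alpha> (q, v) = Poly_Mapping.lookup (snd (Poly_Mapping.lookup w j)) \<alpha>"
      if "j < k" "\<alpha> \<in> multiindices n r" for j \<alpha>
    proof -
      interpret bounded_linear "c' j \<alpha>" using c' by (rule has_derivative_bounded_linear)
      have "c' j \<alpha> (q, v) = c' j \<alpha> (q, 0) + c' j \<alpha> (0, v)"
        using add[of "(q, 0)" "(0, v)"] by simp
      then show ?thesis
        using q(2) that by (simp add: c'_poly trunc_partial_eq[OF q(1)])
    qed
    moreover have "Poly_Mapping.lookup v j = fst (Poly_Mapping.lookup w j)" if "j < k" for j
      using that by (simp add: v_def lookup_sum_single)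
    ultimately have "?f' (q, v) = assemble n k r (\<lambda>j. Poly_Mapping.lookup (fst (Poly_Mapping.lookup w j)))
        (\<lambda>j. Poly_Mapping.lookup (snd (Poly_Mapping.lookup w j)))"
      by (simp add: assemble_def)
    then have "?f' (q, v) = w"
      by (simp add: assemble_coordinates[OF w])
    moreover have "(q, v) \<in> polys n d \<times> tuples k (euclid n)"
      using q(1) v by simp
    ultimately show ?thesis by (rule image_eqI[OF sym])
  qed
  moreover have "?f' h \<in> multijet_space n k r" for h
    by (rule assemble_mem)
  ultimately have "?f' ` (polys n d \<times> tuples k (euclid n)) = multijet_space n k r"
    by (intro equalityI image_subsetI subsetI)
  with trunc_multijet_has_derivative[of n d c' "(p, u)" k r, OF c'] show ?thesis
    by (intro exI conjI)
qed

theorem theorem4p1p4: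
  shows "\<exists>D :: nat \<Rightarrow> nat \<Rightarrow> nat \<Rightarrow> nat. \<forall>n k r d. n \<ge> 1 \<longrightarrow> k \<ge> 1 \<longrightarrow> d \<ge> D n k r \<longrightarrow>
    submersion_on (polys n d \<times> tuples k (euclid n)) (polys n d \<times> configs n k) (multijet_space n k r)
      (\<lambda>(p, u). multijet n k r (poly_eval p) u)"
proof (intro exI[of _ "\<lambda>n k r. (r + 1) * k"] allI impI)
  fix n k r d :: nat
  assume d: "(r + 1) * k \<le> d"
  let ?V = "polys n d \<times> tuples k (euclid n)" and ?M = "polys n d \<times> configs n k"
    and ?W = "multijet_space n k r" and ?F = "\<lambda>(p, u). multijet n k r (poly_eval p) u"
  \<comment> \<open>Agreement on \<open>?M\<close> is enough for the transfer: derivatives within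
    \<open>?M\<close> and the classes \<open>Ck_on\<close> depend only on values there.\<close>
  have F: "?F x = trunc_multijet n k r d x" if "x \<in> ?M" for x
    using that multijet_eq_trunc_multijet by auto
  have "\<exists>f'. (?F has_derivative f') (at x within ?M) \<and> f' ` ?V = ?W" if x: "x \<in> ?M" for x
  proof -
    obtain f' where f': "(trunc_multijet n k r d has_derivative f') (at x)" "f' ` ?V = ?W"
      using trunc_multijet_derivative_surjective[OF _ _ d] x by (metis mem_Sigma_iff surj_pair)
    have "(?F has_derivative f') (at x within ?M)"
      by (rule has_derivative_transform[OF x F has_derivative_at_withinI[OF f'(1)]])
    with f'(2) show ?thesis by blast
  qed
  moreover have "smooth_map_on ?V ?M ?F"
    unfolding smooth_map_on_def
    using Ck_on_cong[OF vector_polynomial_Ck_on[OF vector_polynomial_trunc_multijet] F] by blast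
  moreover have "?F ` ?M \<subseteq> ?W"
    using F by (auto simp: trunc_multijet_def assemble_mem)
  moreover have "openin (top_of_set ?V) ?M"
    by (intro openin_Times openin_configs) simp
  moreover have "subspace ?V" "subspace ?W"
    unfolding multijet_space_def jet_space_eq
    by (intro subspace_Times subspace_tuples subspace_euclid subspace_polys)+
  ultimately show "submersion_on ?V ?M ?W ?F"
    unfolding submersion_on_def by blast
qed

end
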